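(* For every odd positive integer $n$ and every non-negative integer $i$, the polynomial $$f(x)=x^{\frac{3^n-1}{2}+2^i}+2x^{\frac{3^n-1}{2}+3}+2x^{\frac{3^n-1}{2}+2}+2x^{\frac{3^n-1}{2}+1}+x^{2^i}+x^3+x^2+x$$ is a permutation polynomial of $\mathbb{F}_{3^n}$.
   Context: A polynomial is a permutation polynomial (PP) of a finite field if it induces a bijection of that field to itself. *)

theory Defs
  imports "HOL-Computational_Algebra.Polynomial" "HOL-Library.Cardinality"
begin

definition permutation_polynomial :: "'a :: {field, finite} poly \<Rightarrow> bool"
  where "permutation_polynomial p \<longleftrightarrow> bij (poly p)"

end

(* On nonzero squares f(x) = -x^(2^i), and on nonsquares f(x) = -x (x - 1)^2, since x^((3^n - 1)/2)
   is the quadratic character. As n is odd, -1 is a nonsquare, so f exchanges squares and nonsquares.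
   It is injective on squares because squaring is. For a nonsquare x write -x = u^2; then
   f(x) = (u^3 + u)^2, and u^3 + u is additive with trivial kernel because -1 is a nonsquare. *)
theory Submission
  imports Defs
begin

text \<open>Translation by 1 permutes the ring, so adding 1 to every element leaves the sum of all
  elements unchanged.\<close>

lemma of_nat_card_eq_0: "of_nat CARD('a) = (0 :: 'a :: {ring_1, finite})"
proof -
  have "(\<Sum>x\<in>UNIV. x + 1) = (\<Sum>x\<in>UNIV. x :: 'a)"
    by (rule sum.reindex_bij_witness[of _ "\<lambda>x. x - 1" "\<lambda>x. x + 1"]) auto
  then show ?thesis by (simp add: sum.distrib)
qed

(* finite_field_power_card_eq_same is stated for the class finite_field, of which the sort
   {field, finite} is not a syntactic instance. *)
lemma power_card_minus_1_eq_1: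
  fixes x :: "'a :: {field, finite}"
  assumes "x \<noteq> 0"
  shows "x ^ (CARD('a) - 1) = 1"
proof -
  let ?P = "\<Prod>y\<in>UNIV - {0}. y :: 'a"
  have "(\<Prod>y\<in>UNIV - {0}. x * y) = ?P"
    by (rule prod.reindex_bij_witness[of _ "\<lambda>y. y / x" "\<lambda>y. x * y"]) (use assms in auto)
  then have "x ^ (CARD('a) - 1) * ?P = ?P"
    by (simp add: prod.distrib card_Diff_singleton)
  moreover have "?P \<noteq> 0" by simp
  ultimately show ?thesis by simp
qed

context
  fixes m :: nat
  assumes card: "CARD('a :: {field, finite}) = 2 * m + 1" and odd_m: "odd m" and three: "(3 :: 'a) = 0"
begin

lemma minus_one_neq_one: "(- 1 :: 'a) \<noteq> 1"
proof
  assume "(- 1 :: 'a) = 1"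
  moreover have "(3 :: 'a) = 1 - (- 1) + 1" by simp
  ultimately have "(3 :: 'a) = 1" by (metis diff_self add_0)
  with three show False by simp
qed

text \<open>In this context \<open>x ^ m\<close> is the quadratic character: the values 1 and -1
  stand for nonzero squares and nonsquares from here on.\<close>

lemma half_power_cases:
  fixes x :: 'a
  assumes "x \<noteq> 0"
  shows "x ^ m = 1 \<or> x ^ m = - 1"
proof -
  have "(x ^ m) ^ 2 = 1"
    using power_card_minus_1_eq_1[OF assms] card by (simp add: power_mult[symmetric] mult.commute)
  then show ?thesis by (simp add: power2_eq_1_iff)
qed

lemma half_power_uminus: "(- x :: 'a) ^ m = - (x ^ m)"
  using odd_m by (simp add: power_minus_odd)

lemma half_power_square: "x \<noteq> 0 \<Longrightarrow> ((x :: 'a) ^ 2) ^ m = 1"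
  using power_card_minus_1_eq_1[of x] card by (simp add: power_mult[symmetric])

lemma half_power_power:
  fixes x :: 'a
  assumes "x ^ m = 1"
  shows "(x ^ k) ^ m = 1"
proof -
  have "(x ^ k) ^ m = (x ^ m) ^ k" by (simp only: power_mult[symmetric] mult.commute[of k m])
  with assms show ?thesis by simp
qed

lemma obtain_sqrt:
  fixes x :: 'a
  assumes "x ^ m = 1"
  obtains u where "x = u ^ 2"
proof
  \<comment> \<open>As \<open>m\<close> is odd, the exponent (m + 1) / 2 is an integer, and this
    power of \<open>x\<close> squares to \<open>x ^ m * x = x\<close>.\<close>
  have "2 * ((m + 1) div 2) = Suc m" using odd_m by simp
  then have "(x ^ ((m + 1) div 2)) ^ 2 = x ^ Suc m"
    by (simp only: power_mult[symmetric] mult.commute[of _ 2])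
  with assms show "x = (x ^ ((m + 1) div 2)) ^ 2" by simp
qed

lemma square_neq_minus_one: "(w :: 'a) ^ 2 \<noteq> - 1"
proof
  assume w: "w ^ 2 = - 1"
  then have "w \<noteq> 0" by auto
  from half_power_square[OF this] w have "(- 1 :: 'a) ^ m = 1" by simp
  with odd_m minus_one_neq_one show False by simp
qed

text \<open>The only other root is \<open>- y\<close>, whose character is -1 because
  \<open>m\<close> is odd.\<close>

lemma eq_if_square_eq:
  fixes x y :: 'a
  assumes "x ^ m = 1" "y ^ m = 1" "x ^ 2 = y ^ 2"
  shows "x = y"
proof -
  from assms(3) have "x = y \<or> x = - y" by (simp add: power2_eq_iff)
  moreover have "x \<noteq> - y" using assms(1,2) minus_one_neq_one by (auto simp: half_power_uminus)
  ultimately show ?thesis by blast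
qed

text \<open>Powers of squares are squares, so the induction can strip off one squaring at a
  time.\<close>

lemma eq_if_two_power_eq:
  fixes x y :: 'a
  assumes "x ^ m = 1" "y ^ m = 1" "x ^ 2 ^ i = y ^ 2 ^ i"
  shows "x = y"
  using assms(3)
proof (induction i)
  case (Suc i)
  have "(x ^ 2 ^ i) ^ m = 1" "(y ^ 2 ^ i) ^ m = 1"
    using assms(1,2) by (simp_all add: half_power_power)
  moreover have "(x ^ 2 ^ i) ^ 2 = (y ^ 2 ^ i) ^ 2"
    using Suc.prems by (simp add: power_mult[symmetric] mult.commute)
  ultimately show ?case using Suc.IH eq_if_square_eq by blast
qed simp

lemma eq_if_cube_plus_self_eq:
  fixes u v :: 'a
  assumes "u ^ 3 + u = v ^ 3 + v"
  shows "u = v"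
proof -
  \<comment> \<open>The term with factor 3 is the failure of cubing to be additive; it vanishes in
    characteristic 3.\<close>
  have "(u - v) * ((u - v) ^ 2 + 1) = (u ^ 3 + u) - (v ^ 3 + v) - 3 * (u * v * (u - v))"
    by (simp add: power2_eq_square power3_eq_cube algebra_simps)
  with assms three have "(u - v) * ((u - v) ^ 2 + 1) = 0" by simp
  moreover have "(u - v) ^ 2 + 1 \<noteq> 0"
    using square_neq_minus_one by (simp add: add_eq_0_iff2)
  ultimately show ?thesis by simp
qed

lemma eq_if_cubic_eq:
  fixes x y :: 'a
  assumes x: "x ^ m = - 1" and y: "y ^ m = - 1" and eq: "x * (x - 1) ^ 2 = y * (y - 1) ^ 2"
  shows "x = y"
proof -
  obtain u where u: "- x = u ^ 2" by (rule obtain_sqrt[of "- x"]) (simp add: half_power_uminus x)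
  obtain v where v: "- y = v ^ 2" by (rule obtain_sqrt[of "- y"]) (simp add: half_power_uminus y)
  have xy: "x = - (u ^ 2)" "y = - (v ^ 2)" using u v by (metis minus_minus)+
  have "(u ^ 3 + u) ^ 2 = (v ^ 3 + v) ^ 2"
    using eq unfolding xy
    by (simp add: power2_eq_square power3_eq_cube algebra_simps)
  then have "u ^ 3 + u = v ^ 3 + v \<or> u ^ 3 + u = - (v ^ 3 + v)" by (simp only: power2_eq_iff)
  \<comment> \<open>Oddness of the cubic moves the sign onto \<open>v\<close>, where it is harmless
    since only \<open>v ^ 2\<close> determines \<open>y\<close>.\<close>
  moreover have "- (v ^ 3 + v) = (- v) ^ 3 + (- v)" by (simp add: power_minus_odd)
  ultimately have "u = v \<or> u = - v" using eq_if_cube_plus_self_eq by metis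
  with xy show ?thesis by auto
qed

text \<open>Here \<open>- x\<close> is a square, and \<open>x\<close> differs from 1 because 1 has
  character 1, so the other factor is a nonzero square.\<close>

lemma half_power_cubic:
  fixes x :: 'a
  assumes "x ^ m = - 1"
  shows "(- (x * (x - 1) ^ 2)) ^ m = 1"
proof -
  have "x \<noteq> 1" using assms minus_one_neq_one by auto
  then have "((x - 1) ^ 2) ^ m = 1" by (intro half_power_square) simp
  with assms show ?thesis by (simp add: half_power_uminus power_mult_distrib)
qed

lemma half_power_two_power:
  fixes x :: 'a
  assumes "x ^ m = 1"
  shows "(- (x ^ 2 ^ i)) ^ m = - 1"
  using half_power_power[OF assms, of "2 ^ i"] by (simp add: half_power_uminus)

lemma inj_piecewise:
  fixes g :: "'a \<Rightarrow> 'a"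
  assumes zero: "g 0 = 0"
    and square: "\<And>x. x ^ m = 1 \<Longrightarrow> g x = - (x ^ 2 ^ i)"
    and nonsquare: "\<And>x. x ^ m = - 1 \<Longrightarrow> g x = - (x * (x - 1) ^ 2)"
  shows "inj g"
proof (rule injI)
  have m: "m > 0" using odd_m by (rule odd_pos)
  \<comment> \<open>Since \<open>g\<close> negates the character, equal values force arguments of
    equal character, and injectivity need only be checked within each class.\<close>
  have image: "(g x) ^ m = - (x ^ m)" for x
  proof (cases "x = 0")
    case False
    then show ?thesis
      using half_power_cases[of x] half_power_cubic[of x] half_power_two_power[of x i]
        square[of x] nonsquare[of x] by auto
  qed (use zero m in simp)
  fix x y assume eq: "g x = g y"
  then have xy: "x ^ m = y ^ m" using image by (metis minus_minus)
  show "x = y"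
  proof (cases "x = 0")
    case True
    with xy m show ?thesis by (metis power_eq_0_iff)
  next
    case False
    from half_power_cases[OF this] show ?thesis
    proof
      assume x: "x ^ m = 1"
      with xy have y: "y ^ m = 1" by simp
      from eq square[OF x] square[OF y] have "x ^ 2 ^ i = y ^ 2 ^ i" by simp
      with x y show ?thesis by (rule eq_if_two_power_eq)
    next
      assume x: "x ^ m = - 1"
      with xy have y: "y ^ m = - 1" by simp
      from eq nonsquare[OF x] nonsquare[OF y] have "x * (x - 1) ^ 2 = y * (y - 1) ^ 2" by simp
      with x y show ?thesis by (rule eq_if_cubic_eq)
    qed
  qed
qed

end

text \<open>Modulo 4, 9 is 1, so an odd power of 3 is 3.\<close>

lemma odd_half_three_power_minus_1:
  assumes "odd n"
  shows "odd (((3 :: nat) ^ n - 1) div 2)" and "(3 :: nat) ^ n = 2 * ((3 ^ n - 1) div 2) + 1"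
proof -
  obtain k where k: "n = 2 * k + 1" using assms by (rule oddE)
  have "(9 :: nat) ^ k mod 4 = 1" by (induction k) (simp, simp, presburger)
  moreover have "(3 :: nat) ^ n = 3 * 9 ^ k" by (simp add: k power_mult)
  ultimately show "odd (((3 :: nat) ^ n - 1) div 2)" "(3 :: nat) ^ n = 2 * ((3 ^ n - 1) div 2) + 1"
    by presburger+
qed

theorem theorem1p4:
  fixes n i :: nat and f :: "'a :: {field, finite} poly"
  assumes "odd n"
    and "CARD('a) = 3 ^ n"
    and "f = monom 1 ((3 ^ n - 1) div 2 + 2 ^ i) + monom 2 ((3 ^ n - 1) div 2 + 3)
           + monom 2 ((3 ^ n - 1) div 2 + 2) + monom 2 ((3 ^ n - 1) div 2 + 1)
           + monom 1 (2 ^ i) + monom 1 3 + monom 1 2 + monom 1 1"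
  shows "permutation_polynomial f"
proof -
  define m :: nat where "m = (3 ^ n - 1) div 2"
  have odd_m: "odd m" and card: "CARD('a) = 2 * m + 1"
    using odd_half_three_power_minus_1[OF assms(1)] assms(2) by (simp_all add: m_def)
  have "(3 :: 'a) ^ n = 0" using of_nat_card_eq_0[where 'a = 'a] assms(2) by simp
  then have three: "(3 :: 'a) = 0" by simp
  \<comment> \<open>Grouping by \<open>x ^ m\<close> makes one summand vanish in each class: the
    coefficients become 2 and 3 = 0 on nonzero squares, 0 and -1 on nonsquares.\<close>
  have f: "poly f x = (x ^ m + 1) * x ^ 2 ^ i + (2 * x ^ m + 1) * (x ^ 3 + x ^ 2 + x)" for x
    unfolding assms(3) m_def[symmetric]
    by (simp add: poly_monom power_add power2_eq_square algebra_simps)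
  have two: "(2 :: 'a) = - 1" using three by (simp add: eq_neg_iff_add_eq_0)
  have "inj (poly f)"
  proof (rule inj_piecewise[OF card odd_m three])
    show "poly f 0 = 0" by (simp add: f)
  next
    fix x :: 'a assume "x ^ m = 1"
    then have "poly f x = 2 * x ^ 2 ^ i + 3 * (x ^ 3 + x ^ 2 + x)" by (simp add: f)
    with two three show "poly f x = - (x ^ 2 ^ i)" by simp
  next
    fix x :: 'a assume "x ^ m = - 1"
    then have "poly f x = - (x ^ 3 + x ^ 2 + x)" by (simp add: f)
    \<comment> \<open>Modulo 3 the middle coefficient 1 equals -2, which completes the
      square.\<close>
    also have "\<dots> = - (x * (x - 1) ^ 2) - 3 * x ^ 2"
      by (simp add: power2_eq_square power3_eq_cube algebra_simps)
    finally show "poly f x = - (x * (x - 1) ^ 2)" using three by simp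
  qed
  then show ?thesis
    unfolding permutation_polynomial_def bij_def by (simp add: finite_UNIV_inj_surj)
qed

end
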